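(* For a completely regular space $X$ the following are equivalent: (1) $X$ is connected modulo pseudocompactness; (2) $\mathrm{cl}_{\beta X}(\beta X\setminus\upsilon X)$ is connected.
   Context: Completely regular means completely regular and Hausdorff (Tychonoff). $\beta X$ is the Stone--Čech compactification and $\upsilon X$ the Hewitt realcompactification of $X$, with $X\subseteq\upsilon X\subseteq\beta X$. A completely regular space is pseudocompact if every continuous real-valued mapping on it is bounded. An ideal in a set $X$ is a non-empty collection of subsets of $X$ closed under taking subsets and under binary unions (it need not be proper). The ideal $\langle\mathscr{A}\rangle$ generated by a collection $\mathscr{A}$ of subsets of $X$ is the intersection of all ideals in $X$ containing $\mathscr{A}$. For an ideal $\mathscr{H}$ in a space $X$, a mapping $f:X\to[0,1]$ is $2$-valued modulo $\mathscr{H}$ if $f^{-1}(0)\notin\mathscr{H}$, $f^{-1}(1)\notin\mathscr{H}$ and $X\setminus(f^{-1}(0)\cup f^{-1}(1))\in\mathscr{H}$; the space $X$ is connected modulo $\mathscr{H}$ if there is no continuous $f:X\to[0,1]$ which is $2$-valued modulo $\mathscr{H}$. For a completely regular space $X$ let $\mathscr{U}_X=\langle U: U$ is an open subset of $X$ such that $\mathrm{cl}_XU$ is pseudocompact$\rangle$; $X$ is connected modulo pseudocompactness if it is connected modulo $\mathscr{U}_X$. The empty space counts as connected. *)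

theory Defs
  imports "HOL-Analysis.Analysis"
begin

section \<open>Connectedness modulo an ideal\<close>

text \<open>
  Spaces are abstract topologies; the carrier of \<open>X\<close> is \<open>topspace X\<close>, so the ambient type imposes
  no restriction. Complete regularity in the sense used here is
  \<open>completely_regular_space X \<and> Hausdorff_space X\<close>, because the library notion does not include
  the Hausdorff axiom.
\<close>

definition set_ideal :: "'a set \<Rightarrow> 'a set set \<Rightarrow> bool" where
  "set_ideal S H \<longleftrightarrow>
     H \<subseteq> Pow S \<and> H \<noteq> {} \<and>
     (\<forall>A\<in>H. \<forall>B. B \<subseteq> A \<longrightarrow> B \<in> H) \<and>
     (\<forall>A\<in>H. \<forall>B\<in>H. A \<union> B \<in> H)"

definition ideal_generated :: "'a set \<Rightarrow> 'a set set \<Rightarrow> 'a set set" where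
  "ideal_generated S \<A> = \<Inter>{H. set_ideal S H \<and> \<A> \<subseteq> H}"

definition two_valued_modulo :: "'a topology \<Rightarrow> 'a set set \<Rightarrow> ('a \<Rightarrow> real) \<Rightarrow> bool" where
  "two_valued_modulo X H f \<longleftrightarrow>
     {x \<in> topspace X. f x = 0} \<notin> H \<and>
     {x \<in> topspace X. f x = 1} \<notin> H \<and>
     topspace X - ({x \<in> topspace X. f x = 0} \<union> {x \<in> topspace X. f x = 1}) \<in> H"

definition connected_modulo :: "'a topology \<Rightarrow> 'a set set \<Rightarrow> bool" where
  "connected_modulo X H \<longleftrightarrow>
     \<not> (\<exists>f. continuous_map X (top_of_set {0..1}) f \<and> two_valued_modulo X H f)"

definition pseudocompact_space :: "'a topology \<Rightarrow> bool" where
  "pseudocompact_space X \<longleftrightarrow>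
     (\<forall>f. continuous_map X euclideanreal f \<longrightarrow> bounded (f ` topspace X))"

definition pseudocompact_ideal :: "'a topology \<Rightarrow> 'a set set" where
  "pseudocompact_ideal X =
     ideal_generated (topspace X)
       {U. openin X U \<and> pseudocompact_space (subtopology X (X closure_of U))}"

definition connected_modulo_pseudocompactness :: "'a topology \<Rightarrow> bool" where
  "connected_modulo_pseudocompactness X \<longleftrightarrow> connected_modulo X (pseudocompact_ideal X)"


section \<open>The Stone--Cech compactification\<close>

text \<open>
  The Tychonoff construction: the closure of the image of \<open>X\<close> under the evaluation map into
  the cube whose coordinates are all continuous functions from \<open>X\<close> to \<open>[0,1]\<close>. A function on
  \<open>topspace X\<close> is represented by its extensional representative, so there is exactly one
  coordinate for each such function.
\<close>

definition unit_functions :: "'a topology \<Rightarrow> ('a \<Rightarrow> real) set" where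
  "unit_functions X =
     {f \<in> extensional (topspace X). continuous_map X (top_of_set {0..1}) f}"

definition stone_cech_embed :: "'a topology \<Rightarrow> 'a \<Rightarrow> ('a \<Rightarrow> real) \<Rightarrow> real" where
  "stone_cech_embed X x = (\<lambda>f\<in>unit_functions X. f x)"

definition unit_cube :: "'a topology \<Rightarrow> (('a \<Rightarrow> real) \<Rightarrow> real) topology" where
  "unit_cube X = product_topology (\<lambda>_. top_of_set {0..1}) (unit_functions X)"

definition stone_cech :: "'a topology \<Rightarrow> (('a \<Rightarrow> real) \<Rightarrow> real) topology" where
  "stone_cech X =
     subtopology (unit_cube X) (unit_cube X closure_of (stone_cech_embed X ` topspace X))"


section \<open>The Hewitt realcompactification\<close>

text \<open>
  A space is realcompact if it is homeomorphic to a closed subspace of a product of real lines.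
  Indexing the product by real functions on the space loses nothing: the coordinates of an
  embedding are such functions, and repeated coordinates can be dropped.
\<close>

definition realcompact_space :: "'a topology \<Rightarrow> bool" where
  "realcompact_space X \<longleftrightarrow>
     (\<exists>(I :: ('a \<Rightarrow> real) set) C.
        closedin (product_topology (\<lambda>_. euclideanreal) I) C \<and>
        X homeomorphic_space subtopology (product_topology (\<lambda>_. euclideanreal) I) C)"

text \<open>
  The Hewitt realcompactification, located inside the Stone--Cech compactification: the
  realcompact subspace that contains (the copy of) \<open>X\<close> and to which every continuous real
  function on \<open>X\<close> extends. Density of \<open>X\<close> is automatic for subspaces of \<open>stone_cech X\<close>.
  Existence and uniqueness are proved below in \<open>ex1_is_hewitt_realcompactification\<close>.
\<close>

definition is_hewitt_realcompactification ::
    "'a topology \<Rightarrow> (('a \<Rightarrow> real) \<Rightarrow> real) set \<Rightarrow> bool" where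
  "is_hewitt_realcompactification X T \<longleftrightarrow>
     stone_cech_embed X ` topspace X \<subseteq> T \<and> T \<subseteq> topspace (stone_cech X) \<and>
     realcompact_space (subtopology (stone_cech X) T) \<and>
     (\<forall>f. continuous_map X euclideanreal f \<longrightarrow>
        (\<exists>g. continuous_map (subtopology (stone_cech X) T) euclideanreal g \<and>
             (\<forall>x\<in>topspace X. g (stone_cech_embed X x) = f x)))"

definition hewitt_realcompactification :: "'a topology \<Rightarrow> (('a \<Rightarrow> real) \<Rightarrow> real) set" where
  "hewitt_realcompactification X = (THE T. is_hewitt_realcompactification X T)"


section \<open>Well-definedness\<close>

lemma compact_space_stone_cech: "compact_space (stone_cech X)"
proof -
  have "compact_space (unit_cube X)"
    unfolding unit_cube_def
    by (simp add: compact_space_product_topology compact_space_subtopology)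
  then show ?thesis
    unfolding stone_cech_def
    by (simp add: closedin_compact_space compact_space_subtopology)
qed

lemma Hausdorff_space_stone_cech: "Hausdorff_space (stone_cech X)"
  unfolding stone_cech_def unit_cube_def
  by (simp add: Hausdorff_space_product_topology Hausdorff_space_subtopology)

lemma embed_in_unit_cube: "stone_cech_embed X ` topspace X \<subseteq> topspace (unit_cube X)"
proof clarify
  fix x assume x: "x \<in> topspace X"
  have "f x \<in> {0..1}" if "f \<in> unit_functions X" for f
    using that x unfolding unit_functions_def continuous_map_in_subtopology by blast
  then show "stone_cech_embed X x \<in> topspace (unit_cube X)"
    by (simp add: unit_cube_def stone_cech_embed_def)
qed

lemma embed_in_stone_cech: "stone_cech_embed X ` topspace X \<subseteq> topspace (stone_cech X)"
  using closure_of_subset [OF embed_in_unit_cube, of X] embed_in_unit_cube [of X]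
  by (auto simp: stone_cech_def)

lemma dense_in_stone_cech:
  "stone_cech X closure_of (stone_cech_embed X ` topspace X) = topspace (stone_cech X)"
  using closure_of_subset [OF embed_in_unit_cube, of X]
    closure_of_subset_topspace [of "unit_cube X" "stone_cech_embed X ` topspace X"]
  unfolding stone_cech_def
  by (auto simp: closure_of_subtopology Int_absorb1)

lemma embedding_map_stone_cech:
  assumes "completely_regular_space X" "Hausdorff_space X"
  shows "embedding_map X (stone_cech X) (stone_cech_embed X)"
proof -
  let ?K = "mspace (submetric (cfunspace X euclidean_metric) {f. f \<in> topspace X \<rightarrow> {0..1::real}})"
  have "?K = unit_functions X"
    by (auto simp: unit_functions_def continuous_map_in_subtopology image_subset_iff_funcset
             intro: bounded_subset [OF bounded_closed_interval])
  then have "embedding_map X (unit_cube X) (stone_cech_embed X)"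
    using completely_regular_space_cube_embedding_explicit [OF assms]
    by (simp add: unit_cube_def stone_cech_embed_def [abs_def])
  then show ?thesis
    unfolding stone_cech_def
    using closure_of_subset [OF embed_in_unit_cube, of X]
    by (simp add: embedding_map_in_subtopology image_subset_iff_funcset)
qed

lemma stone_cech_extend:
  assumes "continuous_map X (top_of_set {0..1::real}) f"
  obtains g where "continuous_map (stone_cech X) (top_of_set {0..1}) g"
    "\<And>x. x \<in> topspace X \<Longrightarrow> g (stone_cech_embed X x) = f x"
proof -
  let ?f = "restrict f (topspace X)"
  have f: "?f \<in> unit_functions X"
    using assms by (simp add: unit_functions_def)
  show thesis
  proof
    show "continuous_map (stone_cech X) (top_of_set {0..1}) (\<lambda>z. z ?f)"
      unfolding stone_cech_def unit_cube_def
      by (intro continuous_map_from_subtopology continuous_map_product_projection f)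
    show "stone_cech_embed X x ?f = f x" if "x \<in> topspace X" for x
      using f that by (simp add: stone_cech_embed_def)
  qed
qed

text \<open>
  Continuous maps on a subspace of \<open>stone_cech X\<close> containing \<open>X\<close> are determined on \<open>X\<close>.
\<close>

lemma stone_cech_unique:
  assumes T: "stone_cech_embed X ` topspace X \<subseteq> T" and p: "p \<in> T" "p \<in> topspace (stone_cech X)"
    and Y: "Hausdorff_space Y"
    and f: "continuous_map (subtopology (stone_cech X) T) Y f"
    and g: "continuous_map (subtopology (stone_cech X) T) Y g"
    and eq: "\<And>x. x \<in> topspace X \<Longrightarrow> f (stone_cech_embed X x) = g (stone_cech_embed X x)"
  shows "f p = g p"
proof (rule forall_in_closure_of_eq [OF _ Y f g])
  show "p \<in> subtopology (stone_cech X) T closure_of (stone_cech_embed X ` topspace X)"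
    using p T by (simp add: closure_of_subtopology dense_in_stone_cech Int_absorb1)
qed (use eq in auto)

definition extension_points :: "'a topology \<Rightarrow> (('a \<Rightarrow> real) \<Rightarrow> real) set" where
  "extension_points X =
     {p \<in> topspace (stone_cech X). \<forall>f. continuous_map X euclideanreal f \<longrightarrow>
        (\<exists>g. continuous_map (subtopology (stone_cech X)
                 (insert p (stone_cech_embed X ` topspace X))) euclideanreal g \<and>
             (\<forall>x\<in>topspace X. g (stone_cech_embed X x) = f x))}"

lemma embed_in_extension_points:
  assumes "completely_regular_space X" "Hausdorff_space X"
  shows "stone_cech_embed X ` topspace X \<subseteq> extension_points X"
proof clarify
  fix x assume x: "x \<in> topspace X"
  let ?e = "stone_cech_embed X"
  obtain e' where e': "homeomorphic_maps X (subtopology (stone_cech X) (?e ` topspace X)) ?e e'"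
    using embedding_map_stone_cech [OF assms]
    unfolding embedding_map_def homeomorphic_map_maps by blast
  show "?e x \<in> extension_points X"
    unfolding extension_points_def
  proof (rule CollectI, intro conjI allI impI)
    show "?e x \<in> topspace (stone_cech X)"
      using embed_in_stone_cech [of X] x by blast
    fix f :: "'a \<Rightarrow> real" assume f: "continuous_map X euclideanreal f"
    have "continuous_map (subtopology (stone_cech X) (?e ` topspace X)) euclideanreal (f \<circ> e')"
      using e' f by (meson continuous_map_compose homeomorphic_maps_def)
    moreover have "\<forall>x\<in>topspace X. (f \<circ> e') (?e x) = f x"
      using e' by (simp add: homeomorphic_maps_def)
    ultimately show "\<exists>g. continuous_map (subtopology (stone_cech X)
          (insert (?e x) (?e ` topspace X))) euclideanreal g \<and> (\<forall>x\<in>topspace X. g (?e x) = f x)"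
      using x by (metis image_eqI insert_absorb)
  qed
qed

lemma extension_points_extend:
  assumes X: "completely_regular_space X" "Hausdorff_space X"
    and f: "continuous_map X euclideanreal f"
  obtains g where "continuous_map (subtopology (stone_cech X) (extension_points X)) euclideanreal g"
    "\<And>x. x \<in> topspace X \<Longrightarrow> g (stone_cech_embed X x) = f x"
proof -
  let ?e = "stone_cech_embed X"
  have "inj_on ?e (topspace X)"
    using embedding_map_stone_cech [OF X]
    by (simp add: embedding_map_def homeomorphic_eq_everything_map)
  then have inv: "f (inv_into (topspace X) ?e (?e x)) = f x" if "x \<in> topspace X" for x
    using that by simp
  have reg: "regular_space euclideanreal"
    by (simp add: completely_regular_imp_regular_space metrizable_imp_completely_regular_space
          metrizable_space_euclidean)
  have sub: "extension_points X \<subseteq> stone_cech X closure_of (?e ` topspace X)"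
    by (auto simp: dense_in_stone_cech extension_points_def)
  have ex: "\<exists>g. continuous_map (subtopology (stone_cech X) (insert p (?e ` topspace X)))
        euclideanreal g \<and> (\<forall>z \<in> ?e ` topspace X. g z = (f \<circ> inv_into (topspace X) ?e) z)"
    if p: "p \<in> extension_points X" for p
  proof -
    obtain g where "continuous_map (subtopology (stone_cech X) (insert p (?e ` topspace X))) euclideanreal g"
        "\<forall>x\<in>topspace X. g (?e x) = f x"
      using p f unfolding extension_points_def by blast
    then show ?thesis using inv by (intro exI [of _ g]) simp
  qed
  show thesis
  proof (rule continuous_map_extension_pointwise [OF reg embed_in_extension_points [OF X] sub ex])
    fix g
    assume g: "continuous_map (subtopology (stone_cech X) (extension_points X)) euclideanreal g"
      and ge: "\<And>z. z \<in> ?e ` topspace X \<Longrightarrow> g z = (f \<circ> inv_into (topspace X) ?e) z"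
    show thesis
    proof (rule that [OF g])
      show "g (?e x) = f x" if "x \<in> topspace X" for x
        using ge [of "?e x"] inv that by simp
    qed
  qed
qed

lemma extension_point_of_cluster:
  assumes X: "completely_regular_space X" "Hausdorff_space X"
    and p: "p \<in> topspace (stone_cech X)"
    and cl: "\<And>h. continuous_map (subtopology (stone_cech X) (extension_points X)) euclideanreal h \<Longrightarrow>
        \<exists>c. \<forall>\<epsilon>>0. p \<in> stone_cech X closure_of {s \<in> extension_points X. \<bar>h s - c\<bar> < \<epsilon>}"
  shows "p \<in> extension_points X"
proof (cases "p \<in> stone_cech_embed X ` topspace X")
  case True
  then show ?thesis using embed_in_extension_points [OF X] by blast
next
  case pnot: False
  let ?e = "stone_cech_embed X" and ?B = "stone_cech X" and ?T = "extension_points X"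
  have Tsub: "?T \<subseteq> topspace ?B" by (auto simp: extension_points_def)
  have "\<exists>g. continuous_map (subtopology ?B (insert p (?e ` topspace X))) euclideanreal g \<and>
             (\<forall>x\<in>topspace X. g (?e x) = f x)"
    if f: "continuous_map X euclideanreal f" for f
  proof -
    obtain F where F: "continuous_map (subtopology ?B ?T) euclideanreal F"
      and Ff: "\<And>x. x \<in> topspace X \<Longrightarrow> F (?e x) = f x"
      using extension_points_extend [OF X f] by metis
    obtain c where c: "\<And>\<epsilon>. \<epsilon> > 0 \<Longrightarrow> p \<in> ?B closure_of {s \<in> ?T. \<bar>F s - c\<bar> < \<epsilon>}"
      using cl [OF F] by blast
    define k where "k = (\<lambda>t::real. max 0 (min 1 ((t - c + 1) / 2)))"
    have k01: "k t \<in> {0..1}" for t by (simp add: k_def)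
    have kc: "continuous_map euclideanreal euclideanreal k"
      unfolding k_def by (simp add: continuous_intros)
    have "continuous_map X (top_of_set {0..1}) (k \<circ> f)"
      using continuous_map_compose [OF f kc] k01
      by (auto simp: continuous_map_in_subtopology simp del: atLeastAtMost_iff)
    then obtain H where H: "continuous_map ?B (top_of_set {0..1}) H"
      and Hf: "\<And>x. x \<in> topspace X \<Longrightarrow> H (?e x) = k (f x)"
      using stone_cech_extend by (metis comp_apply)
    have Hr: "continuous_map ?B euclideanreal H"
      using H continuous_map_in_subtopology by blast
    have HF: "H s = k (F s)" if "s \<in> ?T" for s
    proof -
      have "H s = (k \<circ> F) s"
      proof (rule stone_cech_unique [OF embed_in_extension_points [OF X] that])
        show "continuous_map (subtopology ?B ?T) euclideanreal H"
          by (simp add: Hr continuous_map_from_subtopology)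
        show "continuous_map (subtopology ?B ?T) euclideanreal (k \<circ> F)"
          by (rule continuous_map_compose [OF F kc])
      qed (use that Tsub Hf Ff in auto)
      then show ?thesis by simp
    qed
    have Hp: "H p = 1/2"
    proof -
      have "\<bar>H p - 1/2\<bar> \<le> \<epsilon>" if "\<epsilon> > 0" for \<epsilon>
      proof -
        have "closedin ?B {z \<in> topspace ?B. H z \<in> cball (1/2) \<epsilon>}"
          by (rule closedin_continuous_map_preimage [OF Hr]) simp
        moreover have "{s \<in> ?T. \<bar>F s - c\<bar> < \<epsilon>} \<subseteq> {z \<in> topspace ?B. H z \<in> cball (1/2) \<epsilon>}"
        proof clarify
          fix s assume s: "s \<in> ?T" "\<bar>F s - c\<bar> < \<epsilon>"
          have "\<bar>1/2 - k (F s)\<bar> \<le> \<bar>F s - c\<bar>"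
            by (simp add: k_def max_def min_def abs_if field_simps)
          then show "s \<in> topspace ?B \<and> H s \<in> cball (1/2) \<epsilon>"
            using s Tsub by (auto simp: HF dist_real_def)
        qed
        ultimately have "p \<in> {z \<in> topspace ?B. H z \<in> cball (1/2) \<epsilon>}"
          using c [OF that] closure_of_minimal by blast
        then show ?thesis by (simp add: dist_real_def abs_minus_commute)
      qed
      then have "\<bar>H p - 1/2\<bar> \<le> 0" by (rule field_le_epsilon) simp
      then show ?thesis by simp
    qed
    let ?S = "subtopology ?B (insert p (?e ` topspace X))"
    have topS: "topspace ?S = insert p (?e ` topspace X)"
      using p embed_in_stone_cech [of X] by auto
    define g where "g z = (if z = p then c else F z)" for z
    have HrS: "continuous_map ?S euclideanreal H"
      by (simp add: Hr continuous_map_from_subtopology)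
    define W where "W = {z \<in> topspace ?S. H z \<in> {0<..<1}}"
    have W: "openin ?S W"
      unfolding W_def by (rule openin_continuous_map_preimage [OF HrS]) simp
    have V: "openin ?S (?e ` topspace X)"
    proof -
      have "Hausdorff_space ?S" by (simp add: Hausdorff_space_stone_cech Hausdorff_space_subtopology)
      then have "closedin ?S {p}" using topS by (simp add: closedin_Hausdorff_singleton)
      then have "openin ?S (topspace ?S - {p})" by blast
      moreover have "topspace ?S - {p} = ?e ` topspace X" using topS pnot by auto
      ultimately show ?thesis by simp
    qed
    have "continuous_map ?S euclideanreal g"
    proof (rule pasting_lemma [where I = "UNIV::bool set"
          and T = "\<lambda>b. if b then W else ?e ` topspace X"
          and f = "\<lambda>b. if b then (\<lambda>z. c - 1 + 2 * H z) else F"])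
      fix b :: bool
      show "openin ?S (if b then W else ?e ` topspace X)" using W V by simp
      have "continuous_map (subtopology ?S W) euclideanreal (\<lambda>z. c - 1 + 2 * H z)"
        by (intro continuous_intros continuous_map_from_subtopology HrS)
      moreover have "continuous_map (subtopology ?S (?e ` topspace X)) euclideanreal F"
      proof -
        have "subtopology ?S (?e ` topspace X) = subtopology (subtopology ?B ?T) (?e ` topspace X)"
          using embed_in_extension_points [OF X]
          by (simp add: subtopology_subtopology Int_absorb1 subset_insertI)
        then show ?thesis by (simp add: F continuous_map_from_subtopology)
      qed
      ultimately show "continuous_map (subtopology ?S (if b then W else ?e ` topspace X)) euclideanreal
             (if b then (\<lambda>z. c - 1 + 2 * H z) else F)" by simp
    next
      have *: "c - 1 + 2 * H z = F z" if "z \<in> W" "z \<in> ?e ` topspace X" for z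
      proof -
        have "H z = k (F z)" using HF that embed_in_extension_points [OF X] by blast
        moreover have "0 < H z" "H z < 1" using that by (auto simp: W_def)
        ultimately show ?thesis by (auto simp: k_def max_def min_def field_simps split: if_splits)
      qed
      show "(if i then (\<lambda>z. c - 1 + 2 * H z) else F) x = (if j then (\<lambda>z. c - 1 + 2 * H z) else F) x"
        if "x \<in> topspace ?S \<inter> (if i then W else ?e ` topspace X) \<inter> (if j then W else ?e ` topspace X)"
        for i j x
        using that * by (auto split: if_splits)
      show "\<exists>j. j \<in> UNIV \<and> x \<in> (if j then W else ?e ` topspace X) \<and>
              g x = (if j then (\<lambda>z. c - 1 + 2 * H z) else F) x" if "x \<in> topspace ?S" for x
      proof (cases "x = p")
        case True
        then show ?thesis
          by (intro exI [of _ True]) (use that Hp in \<open>auto simp: W_def g_def\<close>)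
      next
        case False
        then show ?thesis
          by (intro exI [of _ False]) (use that topS in \<open>auto simp: g_def\<close>)
      qed
    qed
    moreover have "\<forall>x\<in>topspace X. g (?e x) = f x" using Ff pnot by (auto simp: g_def)
    ultimately show ?thesis by blast
  qed
  then show ?thesis using p by (simp add: extension_points_def)
qed

lemma realcompact_extension_points:
  assumes X: "completely_regular_space X" "Hausdorff_space X"
  shows "realcompact_space (subtopology (stone_cech X) (extension_points X))"
proof -
  let ?B = "stone_cech X" and ?T = "extension_points X"
  let ?S = "subtopology (stone_cech X) (extension_points X)"
  define I where "I = {h. continuous_map ?S euclideanreal h}"
  let ?P = "product_topology (\<lambda>_. euclideanreal) I"
  define E where "E = (\<lambda>p. \<lambda>h\<in>I. h p)"
  have topS: "topspace ?S = ?T" by (auto simp: extension_points_def)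
  have E: "continuous_map ?S ?P E"
    by (auto simp: E_def continuous_map_componentwise I_def)
  have *: "\<exists>p. p \<in> A \<and> E p = q" if A: "closedin ?S A" and q: "q \<in> ?P closure_of (E ` A)" for A q
  proof -
    have AT: "A \<subseteq> ?T" using A topS closedin_subset by blast
    then have AB: "A \<subseteq> topspace ?B" by (auto simp: extension_points_def)
    have qP: "q \<in> topspace ?P" using q closure_of_subset_topspace [of ?P] by blast
    define \<N> where "\<N> = {N. openin ?P N \<and> q \<in> N}"
    define D where "D N = ?B closure_of {s \<in> A. E s \<in> N}" for N
    have "\<Inter>(D ` \<N>) \<noteq> {}"
    proof -
      have "\<Inter>\<F> \<noteq> {}" if "finite \<F>" "\<F> \<subseteq> D ` \<N>" for \<F>
      proof -
        obtain \<M> where M: "finite \<M>" "\<M> \<subseteq> \<N>" "\<F> = D ` \<M>"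
          using finite_subset_image \<open>finite \<F>\<close> \<open>\<F> \<subseteq> D ` \<N>\<close> by metis
        define N where "N = topspace ?P \<inter> \<Inter>\<M>"
        have "openin ?P N"
        proof (cases "\<M> = {}")
          case False
          then show ?thesis using M unfolding N_def \<N>_def
            by (intro openin_Int openin_topspace openin_Inter) auto
        qed (auto simp: N_def simp flip: topspace_product_topology)
        moreover have "q \<in> N" using M qP by (auto simp: N_def \<N>_def)
        ultimately obtain s where s: "s \<in> A" "E s \<in> N"
          using q by (auto simp: in_closure_of)
        have "s \<in> D M" if "M \<in> \<M>" for M
        proof -
          have "{s \<in> A. E s \<in> M} \<subseteq> D M"
            unfolding D_def using AB by (intro closure_of_subset) auto
          then show ?thesis using s that by (auto simp: N_def)
        qed
        then show ?thesis using M by auto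
      qed
      moreover have "\<forall>C\<in>D ` \<N>. closedin ?B C" by (auto simp: D_def)
      ultimately show ?thesis
        using compact_space_fip [THEN iffD1, OF compact_space_stone_cech, rule_format, of "D ` \<N>" X]
        by metis
    qed
    then obtain p where p: "\<And>N. N \<in> \<N> \<Longrightarrow> p \<in> D N" by auto
    have "topspace ?P \<in> \<N>" using qP by (simp add: \<N>_def del: topspace_product_topology)
    then have pA: "p \<in> ?B closure_of A"
      using p [of "topspace ?P"] closure_of_mono [of "{s \<in> A. E s \<in> topspace ?P}" A ?B]
      unfolding D_def by auto
    then have pB: "p \<in> topspace ?B" using closure_of_subset_topspace [of ?B] by blast
    have near: "p \<in> ?B closure_of {s \<in> A. \<bar>h s - q h\<bar> < \<epsilon>}" if "h \<in> I" "\<epsilon> > 0" for h \<epsilon>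
    proof -
      have "openin ?P {y \<in> topspace ?P. y h \<in> ball (q h) \<epsilon>}"
        by (rule openin_continuous_map_preimage [OF continuous_map_product_projection [OF \<open>h \<in> I\<close>]]) simp
      then have "{y \<in> topspace ?P. y h \<in> ball (q h) \<epsilon>} \<in> \<N>" (is "?N \<in> _")
        using qP that by (simp add: \<N>_def)
      then have "p \<in> ?B closure_of {s \<in> A. E s \<in> ?N}" using p unfolding D_def by blast
      moreover have "{s \<in> A. E s \<in> ?N} \<subseteq> {s \<in> A. \<bar>h s - q h\<bar> < \<epsilon>}"
        using that by (auto simp: E_def dist_real_def)
      ultimately show ?thesis using closure_of_mono by blast
    qed
    have pT: "p \<in> ?T"
    proof (rule extension_point_of_cluster [OF X pB])
      fix h assume "continuous_map ?S euclideanreal h"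
      then have "h \<in> I" by (simp add: I_def)
      moreover have "?B closure_of {s \<in> A. \<bar>h s - q h\<bar> < \<epsilon>} \<subseteq> ?B closure_of {s \<in> ?T. \<bar>h s - q h\<bar> < \<epsilon>}" for \<epsilon>
        using AT by (intro closure_of_mono) auto
      ultimately show "\<exists>c. \<forall>\<epsilon>>0. p \<in> ?B closure_of {s \<in> ?T. \<bar>h s - c\<bar> < \<epsilon>}"
        using near by blast
    qed
    have "p \<in> ?S closure_of A"
      using pA pT AT by (simp add: closure_of_subtopology Int_absorb1)
    then have "p \<in> A" using A by (simp add: closure_of_closedin)
    moreover have "h p = q h" if "h \<in> I" for h
    proof -
      have h: "continuous_map ?S euclideanreal h" using that by (simp add: I_def)
      have "\<bar>h p - q h\<bar> \<le> \<epsilon>" if "\<epsilon> > 0" for \<epsilon>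
      proof -
        have "closedin ?S {z \<in> topspace ?S. h z \<in> cball (q h) \<epsilon>}"
          by (rule closedin_continuous_map_preimage [OF h]) simp
        moreover have "{s \<in> A. \<bar>h s - q h\<bar> < \<epsilon>} \<subseteq> {z \<in> topspace ?S. h z \<in> cball (q h) \<epsilon>}"
          unfolding topS using AT by (auto simp: dist_real_def)
        moreover have "p \<in> ?S closure_of {s \<in> A. \<bar>h s - q h\<bar> < \<epsilon>}"
        proof -
          have "?T \<inter> {s \<in> A. \<bar>h s - q h\<bar> < \<epsilon>} = {s \<in> A. \<bar>h s - q h\<bar> < \<epsilon>}" using AT by auto
          then show ?thesis using near [OF \<open>h \<in> I\<close> that] pT by (simp add: closure_of_subtopology)
        qed
        ultimately have "p \<in> {z \<in> topspace ?S. h z \<in> cball (q h) \<epsilon>}"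
          using closure_of_minimal by blast
        then show ?thesis by (simp add: dist_real_def abs_minus_commute)
      qed
      then have "\<bar>h p - q h\<bar> \<le> 0" by (rule field_le_epsilon) simp
      then show ?thesis by simp
    qed
    then have "E p = q"
      using qP by (auto simp: E_def PiE_iff extensional_def)
    ultimately show ?thesis by blast
  qed
  have closed: "closed_map ?S ?P E"
    unfolding closed_map_def
  proof (intro allI impI)
    fix A assume A: "closedin ?S A"
    have "?P closure_of (E ` A) \<subseteq> E ` A" using * [OF A] by blast
    moreover have "E ` A \<subseteq> topspace ?P"
      using continuous_map_image_subset_topspace [OF E] closedin_subset [OF A] by blast
    ultimately show "closedin ?P (E ` A)"
      using closure_of_subset_eq by blast
  qed
  have crS: "completely_regular_space ?S"
    by (simp add: Hausdorff_space_stone_cech compact_Hausdorff_or_regular_imp_normal_space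
          compact_space_stone_cech completely_regular_space_subtopology normal_imp_completely_regular_space)
  have hS: "Hausdorff_space ?S"
    by (simp add: Hausdorff_space_stone_cech Hausdorff_space_subtopology)
  have "inj_on E (topspace ?S)"
  proof (rule inj_onI, rule ccontr)
    fix x y assume xy: "x \<in> topspace ?S" "y \<in> topspace ?S" "E x = E y" "x \<noteq> y"
    have "closedin ?S {y}" by (rule closedin_Hausdorff_singleton [OF hS xy(2)])
    then obtain h :: "_ \<Rightarrow> real" where "continuous_map ?S euclideanreal h" "h x = 0" "h ` {y} \<subseteq> {1}"
      using crS [unfolded completely_regular_space_alt, rule_format, of "{y}" x] xy by blast
    then have "h \<in> I" "h x \<noteq> h y" by (auto simp: I_def)
    then show False using \<open>E x = E y\<close> unfolding E_def by (metis restrict_apply')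
  qed
  then have "embedding_map ?S ?P E"
    using E closed injective_closed_imp_embedding_map by blast
  then have "?S homeomorphic_space subtopology ?P (E ` topspace ?S)"
    by (rule embedding_map_imp_homeomorphic_space)
  moreover have "closedin ?P (E ` topspace ?S)"
    using closed unfolding closed_map_def by blast
  ultimately show ?thesis unfolding realcompact_space_def by blast
qed

lemma is_hewitt_extension_points:
  assumes X: "completely_regular_space X" "Hausdorff_space X"
  shows "is_hewitt_realcompactification X (extension_points X)"
  unfolding is_hewitt_realcompactification_def
proof (intro conjI allI impI)
  show "extension_points X \<subseteq> topspace (stone_cech X)"
    by (auto simp: extension_points_def)
  fix f :: "'a \<Rightarrow> real" assume "continuous_map X euclideanreal f"
  then show "\<exists>g. continuous_map (subtopology (stone_cech X) (extension_points X)) euclideanreal g \<and>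
             (\<forall>x\<in>topspace X. g (stone_cech_embed X x) = f x)"
    by (rule extension_points_extend [OF X]) blast
qed (rule embed_in_extension_points [OF X] realcompact_extension_points [OF X])+

lemma is_hewitt_imp_eq_extension_points:
  assumes X: "completely_regular_space X" "Hausdorff_space X"
    and T: "is_hewitt_realcompactification X T"
  shows "T = extension_points X"
proof
  let ?e = "stone_cech_embed X" and ?B = "stone_cech X" and ?T0 = "extension_points X"
  have eT: "?e ` topspace X \<subseteq> T" and TB: "T \<subseteq> topspace ?B"
    and rc: "realcompact_space (subtopology ?B T)"
    and ext: "\<And>f. continuous_map X euclideanreal f \<Longrightarrow>
        \<exists>g. continuous_map (subtopology ?B T) euclideanreal g \<and> (\<forall>x\<in>topspace X. g (?e x) = f x)"
    using T by (auto simp: is_hewitt_realcompactification_def)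
  have e: "continuous_map X ?B ?e"
    using embedding_map_stone_cech [OF X] embedding_map_def homeomorphic_imp_continuous_map
      continuous_map_in_subtopology by blast
  show TT0: "T \<subseteq> ?T0"
  proof
    fix p assume p: "p \<in> T"
    then have "insert p (?e ` topspace X) \<subseteq> T" using eT by blast
    then have "continuous_map (subtopology ?B (insert p (?e ` topspace X))) euclideanreal g"
      if "continuous_map (subtopology ?B T) euclideanreal g" for g
      using that continuous_map_from_subtopology_mono by blast
    then show "p \<in> ?T0" unfolding extension_points_def using p TB ext by blast
  qed
  show "?T0 \<subseteq> T"
  proof
    fix p assume p: "p \<in> ?T0"
    obtain I :: "((('a \<Rightarrow> real) \<Rightarrow> real) \<Rightarrow> real) set" and C
      where C: "closedin (product_topology (\<lambda>_. euclideanreal) I) C"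
        and hom: "subtopology ?B T homeomorphic_space
                  subtopology (product_topology (\<lambda>_. euclideanreal) I) C"
      using rc unfolding realcompact_space_def by blast
    let ?P = "product_topology (\<lambda>_. euclideanreal) I"
    obtain \<phi> \<psi> where hm: "homeomorphic_maps (subtopology ?B T) (subtopology ?P C) \<phi> \<psi>"
      using hom unfolding homeomorphic_space_def by blast
    have \<phi>: "continuous_map (subtopology ?B T) ?P \<phi>" and \<phi>C: "\<And>z. z \<in> T \<Longrightarrow> \<phi> z \<in> C"
      using hm TB unfolding homeomorphic_maps_def continuous_map_in_subtopology by auto
    have \<psi>: "continuous_map (subtopology ?P C) (subtopology ?B T) \<psi>"
      and \<psi>\<phi>: "\<And>z. z \<in> T \<Longrightarrow> \<psi> (\<phi> z) = z"
      using hm TB unfolding homeomorphic_maps_def by auto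
    have eT': "continuous_map X (subtopology ?B T) ?e"
      using e eT unfolding continuous_map_in_subtopology by blast
    have "\<exists>g. continuous_map (subtopology ?B ?T0) euclideanreal g \<and>
              (\<forall>x\<in>topspace X. g (?e x) = \<phi> (?e x) i)" if "i \<in> I" for i
    proof -
      have "continuous_map X euclideanreal (\<lambda>x. \<phi> (?e x) i)"
        using continuous_map_compose [OF eT' \<phi>] that
        by (simp add: continuous_map_componentwise o_def)
      then show ?thesis using extension_points_extend [OF X] by metis
    qed
    then obtain g where g: "\<And>i. i \<in> I \<Longrightarrow> continuous_map (subtopology ?B ?T0) euclideanreal (g i)"
      and ge: "\<And>i x. i \<in> I \<Longrightarrow> x \<in> topspace X \<Longrightarrow> g i (?e x) = \<phi> (?e x) i"
      by metis
    define G where "G z = (\<lambda>i\<in>I. g i z)" for z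
    have G: "continuous_map (subtopology ?B ?T0) ?P G"
      using g by (auto simp: G_def continuous_map_componentwise)
    have Ge: "G (?e x) = \<phi> (?e x)" if "x \<in> topspace X" for x
    proof -
      have "\<phi> (?e x) \<in> extensional I"
        using \<phi> eT TB that unfolding continuous_map_componentwise by auto
      then show ?thesis using ge that by (auto simp: G_def extensional_def)
    qed
    have topT0: "topspace (subtopology ?B ?T0) = ?T0" by (auto simp: extension_points_def)
    have GC: "G z \<in> C" if "z \<in> ?T0" for z
    proof -
      have "closedin (subtopology ?B ?T0) {z \<in> topspace (subtopology ?B ?T0). G z \<in> C}"
        by (rule closedin_continuous_map_preimage [OF G C])
      moreover have "?e ` topspace X \<subseteq> {z \<in> topspace (subtopology ?B ?T0). G z \<in> C}"
        unfolding topT0 using embed_in_extension_points [OF X] Ge \<phi>C eT by auto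
      moreover have "z \<in> subtopology ?B ?T0 closure_of (?e ` topspace X)"
        using that embed_in_extension_points [OF X]
        by (simp add: closure_of_subtopology dense_in_stone_cech Int_absorb1 extension_points_def)
      ultimately show ?thesis using closure_of_minimal by blast
    qed
    have "continuous_map (subtopology ?B ?T0) (subtopology ?P C) G"
      unfolding continuous_map_in_subtopology using G GC topT0 by auto
    then have \<psi>G: "continuous_map (subtopology ?B ?T0) (subtopology ?B T) (\<psi> \<circ> G)"
      using \<psi> continuous_map_compose by blast
    have "(\<psi> \<circ> G) p = id p"
    proof (rule stone_cech_unique [OF embed_in_extension_points [OF X] p _ Hausdorff_space_stone_cech])
      show "continuous_map (subtopology ?B ?T0) ?B (\<psi> \<circ> G)"
        using \<psi>G continuous_map_in_subtopology by blast
      show "continuous_map (subtopology ?B ?T0) ?B id"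
        by (simp add: continuous_map_from_subtopology)
      show "p \<in> topspace ?B" using p topT0 by auto
      show "(\<psi> \<circ> G) (?e x) = id (?e x)" if "x \<in> topspace X" for x
        using that Ge \<psi>\<phi> eT by auto
    qed
    moreover have "(\<psi> \<circ> G) p \<in> T"
      using \<psi>G p topT0 unfolding continuous_map_in_subtopology by auto
    ultimately show "p \<in> T" by simp
  qed
qed

theorem ex1_is_hewitt_realcompactification:
  assumes "completely_regular_space X" "Hausdorff_space X"
  shows "\<exists>!T. is_hewitt_realcompactification X T"
  using is_hewitt_extension_points [OF assms] is_hewitt_imp_eq_extension_points [OF assms] by blast

corollary hewitt_realcompactification_is_hewitt:
  assumes "completely_regular_space X" "Hausdorff_space X"
  shows "is_hewitt_realcompactification X (hewitt_realcompactification X)"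
  unfolding hewitt_realcompactification_def
  by (rule theI' [OF ex1_is_hewitt_realcompactification [OF assms]])

corollary hewitt_realcompactification_eq_extension_points:
  assumes "completely_regular_space X" "Hausdorff_space X"
  shows "hewitt_realcompactification X = extension_points X"
  using hewitt_realcompactification_is_hewitt [OF assms]
    is_hewitt_imp_eq_extension_points [OF assms] by blast

end

theory Submission
  imports Defs
begin

text \<open>
  Write \<open>B\<close> for the Stone--Cech compactification, \<open>T\<close> for the Hewitt realcompactification and
  \<open>K\<close> for the closure of \<open>B - T\<close>. The ideal of \<open>X\<close> is squeezed between two conditions on a set
  \<open>A\<close>: if the closure of \<open>A\<close> in \<open>B\<close> misses \<open>K\<close>, then \<open>A\<close> is in the ideal, and if \<open>A\<close> is in the
  ideal, then its closure in \<open>B\<close> lies in \<open>T\<close>. The two conditions differ (the closure may touch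
  the boundary of \<open>T\<close>), but an open subset of \<open>B\<close> that lies in \<open>T\<close> misses \<open>K\<close>. Hence the
  extension to \<open>B\<close> of a function that is 2-valued modulo the ideal takes exactly the values
  0 and 1 on \<open>K\<close>; conversely a separation of \<open>K\<close> gives such a function by Urysohn's lemma.
\<close>

section \<open>Pseudocompact closures of cozero sets\<close>

text \<open>Pick a sequence in \<open>S\<close> whose terms grow by more than 1 at each step and
  take its range. The uniform gap makes the range closed and every real function on it continuous,
  so Tietze's theorem can prescribe arbitrary values there.\<close>

lemma unbounded_above_discrete_subset:
  fixes S :: "real set"
  assumes S: "\<And>M. \<exists>s\<in>S. M < s"
  obtains D where "D \<subseteq> S" "\<And>M. \<exists>s\<in>D. M < s"
    "\<And>x y. x \<in> D \<Longrightarrow> y \<in> D \<Longrightarrow> dist x y < 1 \<Longrightarrow> x = y"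
proof -
  have "\<exists>s. \<forall>n::nat. s n \<in> S \<and> s n + 1 < s (Suc n)"
    by (rule dependent_nat_choice) (use S in blast)+
  then obtain s where sS: "\<And>n. s n \<in> S" and step: "\<And>n. s n + 1 < s (Suc n)" by blast
  have gap: "s m + 1 \<le> s n" if "m < n" for m n
    using that
  proof (induction n)
    case (Suc n)
    then show ?case using step [of n] by (cases "m = n") auto
  qed simp
  have lower: "s 0 + real n \<le> s n" for n
  proof (induction n)
    case (Suc n)
    then show ?case using step [of n] by simp
  qed simp
  show thesis
  proof (rule that [of "range s"])
    show "range s \<subseteq> S" using sS by blast
    show "\<exists>t\<in>range s. M < t" for M
    proof -
      obtain n where "M - s 0 < real n" using reals_Archimedean2 by blast
      then show ?thesis using lower [of n] by (intro bexI [of _ "s n"]) auto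
    qed
    fix x y assume "x \<in> range s" "y \<in> range s" and d: "dist x y < 1"
    then obtain m n where x: "x = s m" and y: "y = s n" by blast
    show "x = y"
    proof (cases m n rule: linorder_cases)
      case less
      then show ?thesis using gap [of m n] d by (simp add: x y dist_real_def)
    next
      case greater
      then show ?thesis using gap [of n m] d by (simp add: x y dist_real_def)
    qed (simp add: x y)
  qed
qed

text \<open>The difficulty is that the test functions \<open>f\<close> live on the closure only,
  while \<open>bdd\<close> speaks of functions on all of \<open>X\<close>. From an \<open>f\<close>
  unbounded on \<open>U\<close> one builds a function on \<open>X\<close> unbounded on
  \<open>U\<close>: multiplying a function of \<bar>\<open>f\<close>\<bar> by \<open>l\<close>
  forces the value 0 on the boundary of \<open>U\<close>, so the product extends by 0.\<close>

lemma pseudocompact_closure_of_cozero_set: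
  fixes X :: "'a topology" and l :: "'a \<Rightarrow> real"
  assumes l: "continuous_map X euclideanreal l"
    and U: "U = {x \<in> topspace X. 0 < l x}"
    and bdd: "\<And>g. continuous_map X euclideanreal g \<Longrightarrow> bounded (g ` U)"
  shows "pseudocompact_space (subtopology X (X closure_of U))"
  unfolding pseudocompact_space_def
proof (intro allI impI)
  let ?C = "X closure_of U"
  let ?S = "subtopology X ?C"
  fix f :: "'a \<Rightarrow> real"
  assume f: "continuous_map ?S euclideanreal f"
  have UX: "U \<subseteq> topspace X" by (auto simp: U)
  then have UC: "U \<subseteq> ?C" by (rule closure_of_subset)
  have topS: "topspace ?S = ?C" by (simp add: Int_absorb1 closure_of_subset_topspace)
  have "openin X U"
    using openin_continuous_map_preimage [OF l, of "{0<..}"] by (simp add: U)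
  have fU: "bounded (f ` U)"
  proof (rule ccontr)
    assume unb: "\<not> bounded (f ` U)"
    define F where "F = (\<lambda>x. \<bar>f x\<bar>)"
    have F: "continuous_map ?S euclideanreal F"
      unfolding F_def by (intro continuous_map_real_abs f)
    have "\<exists>s\<in>F ` U. M < s" for M
    proof -
      have "\<not> (\<forall>z\<in>f ` U. \<bar>z\<bar> \<le> M)" using unb unfolding bounded_real by blast
      then show ?thesis by (auto simp: F_def not_le)
    qed
    then obtain D where D: "D \<subseteq> F ` U" "\<And>M. \<exists>s\<in>D. M < s"
      and Dd: "\<And>x y. x \<in> D \<Longrightarrow> y \<in> D \<Longrightarrow> dist x y < 1 \<Longrightarrow> x = y"
      using unbounded_above_discrete_subset [of "F ` U"] by blast
    define y where "y = inv_into U F"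
    have y: "y s \<in> U \<and> F (y s) = s" if "s \<in> D" for s
      using that D(1) by (auto simp: y_def f_inv_into_f inv_into_into subset_iff)
    \<comment> \<open>F may blow up only near the boundary of U, where l vanishes; composing F with a
      sufficiently fast growing function makes up for the factor l.\<close>
    have "closed D" using Dd by (intro discrete_imp_closed [of 1]) auto
    moreover have "continuous_on D (\<lambda>s. s / l (y s))"
      unfolding continuous_on_iff
    proof (intro ballI allI impI)
      fix x and e :: real assume "x \<in> D" "0 < e"
      have "dist (x' / l (y x')) (x / l (y x)) < e" if "x' \<in> D" "dist x' x < 1" for x'
        using Dd [OF that(1) \<open>x \<in> D\<close> that(2)] \<open>0 < e\<close> by simp
      then show "\<exists>d>0. \<forall>x'\<in>D. dist x' x < d \<longrightarrow> dist (x' / l (y x')) (x / l (y x)) < e"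
        by (intro exI [of _ 1]) simp
    qed
    ultimately obtain a where a: "continuous_on UNIV a" "\<And>s. s \<in> D \<Longrightarrow> a s = s / l (y s)"
      using Tietze_unbounded [of D "\<lambda>s. s / l (y s)" UNIV] by auto
    define g where "g x = (if x \<in> ?C then a (F x) * l x else 0)" for x
    have "continuous_map X euclideanreal g"
    proof (rule pasting_lemma_closed [where I = "UNIV :: bool set"
          and T = "\<lambda>b. if b then ?C else topspace X - U"
          and f = "\<lambda>b. if b then (\<lambda>x. a (F x) * l x) else (\<lambda>x. 0)"])
      fix b :: bool
      show "closedin X (if b then ?C else topspace X - U)"
        using \<open>openin X U\<close> by (simp add: closedin_diff)
      have "continuous_map ?S euclideanreal (a \<circ> F)"
        using F a(1) by (intro continuous_map_compose [OF F]) auto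
      then have "continuous_map ?S euclideanreal (\<lambda>x. a (F x) * l x)"
        by (intro continuous_map_real_mult [OF _ continuous_map_from_subtopology [OF l]])
          (simp add: o_def)
      then show "continuous_map (subtopology X (if b then ?C else topspace X - U)) euclideanreal
          (if b then (\<lambda>x. a (F x) * l x) else (\<lambda>x. 0))"
        by simp
    next
      \<comment> \<open>On the overlap of the two closed pieces \<open>l\<close> vanishes: it is
        nonnegative on the closure of \<open>U\<close> and nonpositive off \<open>U\<close>.\<close>
      have *: "a (F x) * l x = 0" if "x \<in> ?C" "x \<in> topspace X - U" for x
      proof -
        have "closedin X {x \<in> topspace X. l x \<in> {0..}}"
          by (rule closedin_continuous_map_preimage [OF l]) simp
        then have "?C \<subseteq> {x \<in> topspace X. l x \<in> {0..}}"
          by (rule closure_of_minimal [rotated]) (auto simp: U)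
        then show ?thesis using that by (auto simp: U)
      qed
      show "(if i then (\<lambda>x. a (F x) * l x) else (\<lambda>x. 0)) x = (if j then (\<lambda>x. a (F x) * l x) else (\<lambda>x. 0)) x"
        if "x \<in> topspace X \<inter> (if i then ?C else topspace X - U) \<inter> (if j then ?C else topspace X - U)"
        for i j x
        using that * by (auto split: if_splits)
      show "\<exists>j. j \<in> UNIV \<and> x \<in> (if j then ?C else topspace X - U) \<and>
          g x = (if j then (\<lambda>x. a (F x) * l x) else (\<lambda>x. 0)) x" if "x \<in> topspace X" for x
        by (intro exI [of _ "x \<in> ?C"]) (use that UC in \<open>auto simp: g_def\<close>)
    qed auto
    then obtain M where M: "\<And>x. x \<in> U \<Longrightarrow> \<bar>g x\<bar> \<le> M"
      using bdd unfolding bounded_real by blast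
    obtain s where s: "s \<in> D" "M < s" using D(2) by blast
    then have ys: "y s \<in> U" "F (y s) = s" using y by auto
    \<comment> \<open>The prescribed value of \<open>a\<close> at \<open>s\<close> cancels the
      factor \<open>l (y s)\<close>, which is nonzero because \<open>y s\<close> lies in
      \<open>U\<close>.\<close>
    then have "g (y s) = s" using s a(2) UC by (auto simp: g_def U)
    then show False using M [OF ys(1)] s(2) by simp
  qed
  have "f ` ?C \<subseteq> closure (f ` U)"
  proof -
    have "?S closure_of U = ?C"
      using UC by (simp add: closure_of_subtopology Int_absorb1)
    then show ?thesis
      using continuous_map_image_closure_subset [OF f, of U] by simp
  qed
  then show "bounded (f ` topspace ?S)"
    unfolding topS by (rule bounded_subset [OF bounded_closure [OF fU]])
qed

section \<open>Closures in \<open>B\<close> of members of the ideal\<close>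

text \<open>Some \<open>f\<close> on \<open>X\<close> does not extend continuously to
  \<open>p\<close>. Squeeze \<open>f\<close> into the open unit interval and extend the result to
  \<open>G\<close> on \<open>B\<close>. If \<open>G p\<close> were strictly between 0 and 1, undoing
  the squeeze would extend \<open>f\<close> to \<open>p\<close>; so \<open>G p\<close> is an
  endpoint, and \<open>G * (1 - G)\<close> handles both endpoints at once.\<close>

lemma not_extension_point_imp_zero:
  assumes p: "p \<in> topspace (stone_cech X)" "p \<notin> extension_points X"
  obtains h where "continuous_map (stone_cech X) euclideanreal h" "h p = 0"
    "\<And>x. x \<in> topspace X \<Longrightarrow> 0 < h (stone_cech_embed X x)"
proof -
  let ?e = "stone_cech_embed X" and ?B = "stone_cech X"
  let ?S = "subtopology ?B (insert p (?e ` topspace X))"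
  obtain f where f: "continuous_map X euclideanreal f"
    and nog: "\<And>g. continuous_map ?S euclideanreal g \<Longrightarrow> \<exists>x\<in>topspace X. g (?e x) \<noteq> f x"
    using p unfolding extension_points_def by blast
  have pos: "1 + \<bar>t\<bar> > 0" for t :: real by simp
  \<comment> \<open>an order isomorphism from the real line onto the open unit interval, and its inverse\<close>
  define u where "u t = (1 + t / (1 + \<bar>t\<bar>)) / 2" for t :: real
  define v where "v s = (2 * s - 1) / (1 - \<bar>2 * s - 1\<bar>)" for s :: real
  have abs_u: "\<bar>t / (1 + \<bar>t\<bar>)\<bar> = \<bar>t\<bar> / (1 + \<bar>t\<bar>)" for t :: real
    by (simp add: abs_divide)
  have u01: "0 < u t" "u t < 1" for t
  proof -
    have "\<bar>t\<bar> / (1 + \<bar>t\<bar>) < 1" using pos [of t] by (simp add: divide_less_eq)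
    then have "\<bar>t / (1 + \<bar>t\<bar>)\<bar> < 1" by (simp only: abs_u)
    then have "-1 < t / (1 + \<bar>t\<bar>)" "t / (1 + \<bar>t\<bar>) < 1" by linarith+
    then show "0 < u t" "u t < 1" by (simp_all add: u_def)
  qed
  have vu: "v (u t) = t" for t
  proof -
    have "2 * ((1 + w) / 2) - 1 = w" for w :: real by (simp add: field_simps)
    then have 1: "2 * u t - 1 = t / (1 + \<bar>t\<bar>)" unfolding u_def .
    have "1 - \<bar>t\<bar> / (1 + \<bar>t\<bar>) = 1 / (1 + \<bar>t\<bar>)"
      using pos [of t] by (simp add: divide_simps)
    then show ?thesis unfolding v_def 1 abs_u using pos [of t] by simp
  qed
  have "continuous_map X euclideanreal (\<lambda>x. u (f x))"
    unfolding u_def by (intro continuous_intros f) (use pos in \<open>simp_all add: less_imp_neq [symmetric]\<close>)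
  then have "continuous_map X (top_of_set {0..1}) (\<lambda>x. u (f x))"
    using u01 by (auto simp: continuous_map_in_subtopology less_imp_le)
  then obtain G where G: "continuous_map ?B (top_of_set {0..1}) G"
    and Ge: "\<And>x. x \<in> topspace X \<Longrightarrow> G (?e x) = u (f x)"
    using stone_cech_extend by metis
  have Gr: "continuous_map ?B euclideanreal G" and G01: "G p \<in> {0..1}"
    using G p(1) unfolding continuous_map_in_subtopology by auto
  show thesis
  proof
    show "continuous_map ?B euclideanreal (\<lambda>z. G z * (1 - G z))"
      by (intro continuous_intros Gr)
    show "0 < G (?e x) * (1 - G (?e x))" if "x \<in> topspace X" for x
      using that u01 by (simp add: Ge)
    show "G p * (1 - G p) = 0"
    proof (rule ccontr)
      assume "G p * (1 - G p) \<noteq> 0"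
      then have "0 < G p" "G p < 1" using G01 by auto
      then have in01: "0 < G z" "G z < 1" if z: "z \<in> topspace ?S" for z
      proof -
        consider "z = p" | x where "x \<in> topspace X" "z = ?e x" using z by auto
        then show "0 < G z" "G z < 1" using \<open>0 < G p\<close> \<open>G p < 1\<close> u01 by (cases, simp_all add: Ge)+
      qed
      \<comment> \<open>The denominator of \<open>v\<close> vanishes only at 0 and 1, values that
        \<open>G\<close> avoids on \<open>?S\<close>.\<close>
      have "1 - \<bar>2 * G z - 1\<bar> \<noteq> 0" if "z \<in> topspace ?S" for z
        using in01 [OF that] by linarith
      then have "continuous_map ?S euclideanreal (\<lambda>z. v (G z))"
        unfolding v_def
        by (intro continuous_intros continuous_map_from_subtopology Gr)
      then obtain x where "x \<in> topspace X" "v (G (?e x)) \<noteq> f x" using nog by blast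
      then show False by (simp add: Ge vu)
    qed
  qed
qed

text \<open>At a limit point \<open>p\<close> outside \<open>extension_points X\<close> some
  \<open>h\<close>, positive on \<open>X\<close>, vanishes. Pseudocompactness bounds its reciprocal
  on the closure of \<open>A\<close>, so \<open>h\<close> stays away from 0 on \<open>A\<close> and
  hence at \<open>p\<close>, a contradiction.\<close>

lemma closure_of_pseudocompact_subset_extension_points:
  assumes A: "A \<subseteq> topspace X"
    and e: "continuous_map X (stone_cech X) (stone_cech_embed X)"
    and pc: "pseudocompact_space (subtopology X (X closure_of A))"
  shows "stone_cech X closure_of (stone_cech_embed X ` A) \<subseteq> extension_points X"
proof (rule subsetI, rule ccontr)
  let ?e = "stone_cech_embed X" and ?B = "stone_cech X"
  fix p assume p: "p \<in> ?B closure_of (?e ` A)" and pn: "p \<notin> extension_points X"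
  then have "p \<in> topspace ?B" using closure_of_subset_topspace [of ?B] by blast
  then obtain h where h: "continuous_map ?B euclideanreal h" and hp: "h p = 0"
    and hX: "\<And>x. x \<in> topspace X \<Longrightarrow> 0 < h (?e x)"
    using not_extension_point_imp_zero pn by metis
  have "continuous_map X euclideanreal (\<lambda>x. h (?e x))"
    using continuous_map_compose [OF e h] by (simp add: o_def)
  then have "continuous_map X euclideanreal (\<lambda>x. 1 / h (?e x))"
    using hX by (intro continuous_map_real_divide) (auto simp: less_imp_neq [symmetric])
  then have "continuous_map (subtopology X (X closure_of A)) euclideanreal (\<lambda>x. 1 / h (?e x))"
    by (rule continuous_map_from_subtopology)
  then have "bounded ((\<lambda>x. 1 / h (?e x)) ` topspace (subtopology X (X closure_of A)))"
    using pc unfolding pseudocompact_space_def by blast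
  then obtain M where "M > 0"
    and M: "\<And>x. x \<in> topspace (subtopology X (X closure_of A)) \<Longrightarrow> \<bar>1 / h (?e x)\<bar> \<le> M"
    unfolding bounded_pos by auto
  have "1 / M \<le> h (?e x)" if "x \<in> A" for x
  proof -
    have "x \<in> topspace X" "x \<in> X closure_of A" using that A closure_of_subset [OF A] by auto
    then show ?thesis using M [of x] hX [of x] \<open>M > 0\<close> by (simp add: field_simps)
  qed
  moreover have "?e ` A \<subseteq> topspace ?B" using A embed_in_stone_cech [of X] by blast
  ultimately have "?e ` A \<subseteq> {z \<in> topspace ?B. h z \<in> {1 / M..}}" by auto
  moreover have "closedin ?B {z \<in> topspace ?B. h z \<in> {1 / M..}}"
    by (rule closedin_continuous_map_preimage [OF h]) simp
  ultimately have "p \<in> {z \<in> topspace ?B. h z \<in> {1 / M..}}"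
    using p closure_of_minimal by blast
  then show False using hp \<open>M > 0\<close> by simp
qed

lemma continuous_map_stone_cech_embed:
  assumes "completely_regular_space X" "Hausdorff_space X"
  shows "continuous_map X (stone_cech X) (stone_cech_embed X)"
  using embedding_map_stone_cech [OF assms] embedding_map_def homeomorphic_imp_continuous_map
    continuous_map_in_subtopology by blast

lemma pseudocompact_ideal_downward:
  assumes "A \<in> pseudocompact_ideal X" "C \<subseteq> A"
  shows "C \<in> pseudocompact_ideal X"
  unfolding pseudocompact_ideal_def ideal_generated_def
proof (rule InterI, elim CollectE conjE)
  fix H
  assume H: "set_ideal (topspace X) H"
    "{U. openin X U \<and> pseudocompact_space (subtopology X (X closure_of U))} \<subseteq> H"
  then have "A \<in> H"
    using assms(1) unfolding pseudocompact_ideal_def ideal_generated_def by blast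
  then show "C \<in> H" using H(1) assms(2) unfolding set_ideal_def by blast
qed

text \<open>The sets with this property form an ideal, since closure is monotone and commutes with
  binary unions, and this ideal contains the generators; so it contains the generated ideal.\<close>

lemma closure_of_pseudocompact_ideal_subset:
  assumes X: "completely_regular_space X" "Hausdorff_space X"
    and A: "A \<in> pseudocompact_ideal X"
  shows "stone_cech X closure_of (stone_cech_embed X ` A) \<subseteq> extension_points X"
proof -
  let ?e = "stone_cech_embed X" and ?B = "stone_cech X"
  let ?H = "{A. A \<subseteq> topspace X \<and> ?B closure_of (?e ` A) \<subseteq> extension_points X}"
  have "set_ideal (topspace X) ?H"
    unfolding set_ideal_def
  proof (intro conjI ballI allI impI)
    have "{} \<in> ?H" by simp
    then show "?H \<noteq> {}" by blast
    show "C \<in> ?H" if "A \<in> ?H" "C \<subseteq> A" for A C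
      using that closure_of_mono [of "?e ` C" "?e ` A" ?B] by auto
    show "A \<union> C \<in> ?H" if "A \<in> ?H" "C \<in> ?H" for A C
      using that by (simp add: image_Un)
  qed blast
  moreover have "{U. openin X U \<and> pseudocompact_space (subtopology X (X closure_of U))} \<subseteq> ?H"
    using closure_of_pseudocompact_subset_extension_points continuous_map_stone_cech_embed [OF X]
      openin_subset by blast
  ultimately show ?thesis
    using A unfolding pseudocompact_ideal_def ideal_generated_def by blast
qed

section \<open>Members of the ideal obtained from closed sets away from \<open>B - T\<close>\<close>

text \<open>Urysohn's lemma puts \<open>A\<close> inside a cozero set \<open>U\<close> whose image
  lies in a compact set \<open>Q\<close> contained in \<open>T\<close>. Every real function on
  \<open>X\<close> extends to \<open>T\<close>, so it is bounded on \<open>U\<close>, and the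
  closure of \<open>U\<close> is pseudocompact. Allowing any closed \<open>Z\<close> around the
  image of \<open>A\<close> lets preimages under continuous functions serve directly.\<close>

lemma in_pseudocompact_ideal_if_disjnt:
  assumes X: "completely_regular_space X" "Hausdorff_space X"
    and A: "A \<subseteq> topspace X" "stone_cech_embed X ` A \<subseteq> Z" "closedin (stone_cech X) Z"
    and disj: "disjnt Z (stone_cech X closure_of (topspace (stone_cech X) - extension_points X))"
  shows "A \<in> pseudocompact_ideal X"
proof -
  let ?e = "stone_cech_embed X" and ?B = "stone_cech X" and ?T = "extension_points X"
  let ?K = "?B closure_of (topspace ?B - ?T)"
  have "normal_space ?B"
    by (simp add: Hausdorff_space_stone_cech compact_Hausdorff_or_regular_imp_normal_space
          compact_space_stone_cech)
  then obtain \<phi> where \<phi>: "continuous_map ?B euclideanreal \<phi>"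
      and \<phi>K: "\<phi> ` ?K \<subseteq> {0}" and \<phi>Z: "\<phi> ` Z \<subseteq> {1::real}"
    using Urysohn_lemma_alt [of ?B ?K Z 0 1] A(3) disj by (auto simp: disjnt_sym)
  \<comment> \<open>Any level strictly between 0 and 1 would do: the open set above it contains
    \<open>A\<close>, and the closed set \<open>Q\<close> at or above it still misses
    \<open>?K\<close>.\<close>
  define l where "l x = \<phi> (?e x) - 1/2" for x
  have l: "continuous_map X euclideanreal l"
    using continuous_map_compose [OF continuous_map_stone_cech_embed [OF X] \<phi>]
    unfolding l_def by (intro continuous_intros) (simp add: o_def)
  define U where "U = {x \<in> topspace X. 0 < l x}"
  have U: "openin X U"
    using openin_continuous_map_preimage [OF l, of "{0<..}"] by (simp add: U_def)
  define Q where "Q = {z \<in> topspace ?B. \<phi> z \<in> {1/2..}}"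
  have "closedin ?B Q"
    unfolding Q_def by (rule closedin_continuous_map_preimage [OF \<phi>]) simp
  then have Q: "compactin ?B Q"
    by (simp add: closedin_compact_space compact_space_stone_cech)
  have "topspace ?B - ?T \<subseteq> ?K" by (rule closure_of_subset) simp
  moreover have "\<phi> z = 0" if "z \<in> ?K" for z using \<phi>K that by blast
  ultimately have QT: "Q \<subseteq> ?T" by (fastforce simp: Q_def)
  have UQ: "?e ` U \<subseteq> Q"
    using embed_in_stone_cech [of X] by (auto simp: U_def Q_def l_def)
  have "bounded (g ` U)" if g: "continuous_map X euclideanreal g" for g
  proof -
    obtain G where G: "continuous_map (subtopology ?B ?T) euclideanreal G"
      and Ge: "\<And>x. x \<in> topspace X \<Longrightarrow> G (?e x) = g x"
      using extension_points_extend [OF X g] by metis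
    have "compactin (subtopology ?B ?T) Q" using Q QT by (simp add: compactin_subtopology)
    then have "compact (G ` Q)" using image_compactin [OF _ G] by simp
    moreover have "g ` U \<subseteq> G ` Q"
    proof
      fix t assume "t \<in> g ` U"
      then obtain x where x: "x \<in> U" "t = g x" by blast
      then have "t = G (?e x)" by (simp add: Ge U_def)
      then show "t \<in> G ` Q" using UQ x by blast
    qed
    ultimately show ?thesis using compact_imp_bounded bounded_subset by blast
  qed
  then have "pseudocompact_space (subtopology X (X closure_of U))"
    by (rule pseudocompact_closure_of_cozero_set [OF l U_def])
  then have "U \<in> pseudocompact_ideal X"
    using U unfolding pseudocompact_ideal_def ideal_generated_def by blast
  moreover have "A \<subseteq> U"
  proof
    fix x assume x: "x \<in> A"
    then have "?e x \<in> Z" using A(2) by blast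
    then have "\<phi> (?e x) = 1" using \<phi>Z by blast
    then show "x \<in> U" using x A(1) by (auto simp: U_def l_def)
  qed
  ultimately show ?thesis by (rule pseudocompact_ideal_downward)
qed

text \<open>This is density of \<open>X\<close> in \<open>B\<close>. It turns the information that
  the trace of \<open>W\<close> on \<open>X\<close> is in the ideal into an inclusion of
  \<open>W\<close> itself in \<open>T\<close>.\<close>

lemma openin_stone_cech_subset_closure_of:
  assumes "openin (stone_cech X) W"
  shows "W \<subseteq> stone_cech X closure_of
    (stone_cech_embed X ` {x \<in> topspace X. stone_cech_embed X x \<in> W})"
proof -
  let ?e = "stone_cech_embed X" and ?B = "stone_cech X"
  have "W \<subseteq> ?B closure_of (W \<inter> ?e ` topspace X)"
    using openin_Int_closure_of_subset [OF assms, of "?e ` topspace X"] openin_subset [OF assms]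
    by (simp add: dense_in_stone_cech Int_absorb2)
  moreover have "W \<inter> ?e ` topspace X = ?e ` {x \<in> topspace X. ?e x \<in> W}" by blast
  ultimately show ?thesis by simp
qed

section \<open>Separations of \<open>K\<close> and functions 2-valued modulo the ideal\<close>

theorem theorem3p18:
  fixes X :: "'a topology"
  assumes "completely_regular_space X" and "Hausdorff_space X"
  shows "connected_modulo_pseudocompactness X \<longleftrightarrow>
         connectedin (stone_cech X)
           (stone_cech X closure_of (topspace (stone_cech X) - hewitt_realcompactification X))"
proof -
  let ?e = "stone_cech_embed X" and ?B = "stone_cech X" and ?T = "extension_points X"
  let ?H = "pseudocompact_ideal X"
  define K where "K = ?B closure_of (topspace ?B - ?T)"
  have K: "closedin ?B K" by (simp add: K_def)
  have KB: "K \<subseteq> topspace ?B" by (simp add: K_def closure_of_subset_topspace)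
  have eB: "?e x \<in> topspace ?B" if "x \<in> topspace X" for x
    using that embed_in_stone_cech [of X] by blast
  have e: "continuous_map X ?B ?e" by (rule continuous_map_stone_cech_embed [OF assms])
  have small: "A \<in> ?H" if "A \<subseteq> topspace X" "?e ` A \<subseteq> Z" "closedin ?B Z" "disjnt Z K" for A Z
    using in_pseudocompact_ideal_if_disjnt [OF assms] that unfolding K_def by blast
  \<comment> \<open>Used also in contrapositive form: an open set that meets \<open>K\<close> has a
    trace on \<open>X\<close> outside the ideal.\<close>
  have open_disjnt: "disjnt W K"
    if W: "openin ?B W" and WH: "{x \<in> topspace X. ?e x \<in> W} \<in> ?H" for W
  proof -
    have "W \<subseteq> ?T"
      using openin_stone_cech_subset_closure_of [OF W]
        closure_of_pseudocompact_ideal_subset [OF assms WH] by blast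
    then have "disjnt W (topspace ?B - ?T)" by (auto simp: disjnt_iff)
    then show ?thesis
      using W openin_Int_closure_of_eq_empty [OF W] by (simp add: K_def disjnt_def)
  qed
  have "connected_modulo X ?H \<longleftrightarrow> connectedin ?B K"
  proof
    assume con: "connected_modulo X ?H"
    show "connectedin ?B K"
    proof (rule ccontr)
      assume "\<not> connectedin ?B K"
      then obtain C D where CD: "closedin ?B C" "closedin ?B D" "K \<subseteq> C \<union> D"
          "C \<inter> D \<inter> K = {}" "C \<inter> K \<noteq> {}" "D \<inter> K \<noteq> {}"
        using KB unfolding connectedin_closedin by blast
      have "normal_space ?B"
        by (simp add: Hausdorff_space_stone_cech compact_Hausdorff_or_regular_imp_normal_space
              compact_space_stone_cech)
      moreover have "closedin ?B (C \<inter> K)" "closedin ?B (D \<inter> K)" "disjnt (C \<inter> K) (D \<inter> K)"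
        using CD K by (auto simp: disjnt_iff)
      ultimately obtain F where F: "continuous_map ?B euclideanreal F"
          and F0: "F ` (C \<inter> K) \<subseteq> {0}" and F1: "F ` (D \<inter> K) \<subseteq> {1::real}"
        using Urysohn_lemma_alt [of ?B "C \<inter> K" "D \<inter> K" 0 1] by auto
      \<comment> \<open>The rescaling makes \<open>f\<close> equal to 0 where \<open>F\<close> is at
        most 1/3 and to 1 where \<open>F\<close> is at least 2/3. Thus each of the two fibres
        contains the trace of an open set meeting \<open>K\<close>, and the remaining points map
        into a closed band on which \<open>F\<close> is neither 0 nor 1.\<close>
      define f where "f x = max 0 (min 1 (3 * F (?e x) - 1))" for x
      have "continuous_map X euclideanreal (\<lambda>x. F (?e x))"
        using continuous_map_compose [OF e F] by (simp add: o_def)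
      then have "continuous_map X euclideanreal f"
        unfolding f_def by (intro continuous_intros)
      then have f: "continuous_map X (top_of_set {0..1}) f"
        by (auto simp: continuous_map_in_subtopology f_def)
      have "openin ?B {z \<in> topspace ?B. F z \<in> {..<1/3}}" (is "openin _ ?W0")
        by (rule openin_continuous_map_preimage [OF F]) simp
      moreover have "\<not> disjnt ?W0 K"
      proof -
        obtain z where "z \<in> C \<inter> K" using CD(5) by blast
        moreover have "F z = 0" using F0 \<open>z \<in> C \<inter> K\<close> by blast
        ultimately show ?thesis using KB by (auto simp: disjnt_iff intro!: exI [of _ z])
      qed
      ultimately have W0: "{x \<in> topspace X. ?e x \<in> ?W0} \<notin> ?H" using open_disjnt by blast
      have "openin ?B {z \<in> topspace ?B. F z \<in> {2/3<..}}" (is "openin _ ?W1")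
        by (rule openin_continuous_map_preimage [OF F]) simp
      moreover have "\<not> disjnt ?W1 K"
      proof -
        obtain z where "z \<in> D \<inter> K" using CD(6) by blast
        moreover have "F z = 1" using F1 \<open>z \<in> D \<inter> K\<close> by blast
        ultimately show ?thesis using KB by (auto simp: disjnt_iff intro!: exI [of _ z])
      qed
      ultimately have W1: "{x \<in> topspace X. ?e x \<in> ?W1} \<notin> ?H" using open_disjnt by blast
      have "{x \<in> topspace X. f x = 0} \<notin> ?H"
        using W0 by (rule contrapos_nn) (erule pseudocompact_ideal_downward, auto simp: f_def eB)
      moreover have "{x \<in> topspace X. f x = 1} \<notin> ?H"
        using W1 by (rule contrapos_nn) (erule pseudocompact_ideal_downward, auto simp: f_def eB)
      moreover have "topspace X - ({x \<in> topspace X. f x = 0} \<union> {x \<in> topspace X. f x = 1}) \<in> ?H"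
      proof (rule small)
        show "closedin ?B {z \<in> topspace ?B. F z \<in> {1/3..2/3}}"
          by (rule closedin_continuous_map_preimage [OF F]) simp
        show "disjnt {z \<in> topspace ?B. F z \<in> {1/3..2/3}} K"
        proof -
          have "F z = 0 \<or> F z = 1" if "z \<in> K" for z using that CD(3) F0 F1 by blast
          then show ?thesis by (fastforce simp: disjnt_iff)
        qed
        show "?e ` (topspace X - ({x \<in> topspace X. f x = 0} \<union> {x \<in> topspace X. f x = 1}))
            \<subseteq> {z \<in> topspace ?B. F z \<in> {1/3..2/3}}"
          using eB by (auto simp: f_def max_def min_def split: if_splits)
      qed auto
      ultimately show False
        using con f unfolding connected_modulo_def two_valued_modulo_def by blast
    qed
  next
    assume con: "connectedin ?B K"
    show "connected_modulo X ?H"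
      unfolding connected_modulo_def
    proof (rule notI, elim exE conjE)
      fix f assume f: "continuous_map X (top_of_set {0..1}) f" and two: "two_valued_modulo X ?H f"
      obtain F where F: "continuous_map ?B (top_of_set {0..1}) F"
        and Fe: "\<And>x. x \<in> topspace X \<Longrightarrow> F (?e x) = f x"
        using stone_cech_extend [OF f] by metis
      have Fr: "continuous_map ?B euclideanreal F" and F01: "\<And>z. z \<in> topspace ?B \<Longrightarrow> F z \<in> {0..1}"
        using F unfolding continuous_map_in_subtopology by auto
      have f01: "f x \<in> {0..1}" if "x \<in> topspace X" for x
        using F01 [OF eB [OF that]] Fe [OF that] by simp
      have closed: "closedin ?B {z \<in> topspace ?B. F z \<in> {c}}" for c
        by (rule closedin_continuous_map_preimage [OF Fr]) simp
      \<comment> \<open>The level set of \<open>F\<close> is closed and contains the image of the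
        fibre of \<open>f\<close>; if it missed \<open>K\<close>, the fibre would be in the ideal by
        \<open>small\<close>.\<close>
      have hits: "K \<inter> {z \<in> topspace ?B. F z \<in> {c}} \<noteq> {}"
        if c: "{x \<in> topspace X. f x = c} \<notin> ?H" for c
      proof
        assume "K \<inter> {z \<in> topspace ?B. F z \<in> {c}} = {}"
        then have "{x \<in> topspace X. f x = c} \<in> ?H"
          by (intro small [OF _ _ closed [of c]]) (use eB Fe in \<open>auto simp: disjnt_def\<close>)
        then show False using c by blast
      qed
      \<comment> \<open>The trace of \<open>?W\<close> on \<open>X\<close> is the exceptional set of
        \<open>f\<close>, which is in the ideal. So \<open>?W\<close> misses \<open>K\<close>, and
        the level sets of 0 and 1 separate \<open>K\<close>.\<close>
      have "openin ?B {z \<in> topspace ?B. F z \<in> {0<..<1}}" (is "openin _ ?W")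
        by (rule openin_continuous_map_preimage [OF Fr]) simp
      moreover have "{x \<in> topspace X. ?e x \<in> ?W} =
          topspace X - ({x \<in> topspace X. f x = 0} \<union> {x \<in> topspace X. f x = 1})"
        using eB Fe f01 by (auto simp: less_le)
      ultimately have "disjnt ?W K"
        using two by (intro open_disjnt) (simp_all add: two_valued_modulo_def)
      moreover have "F z = 0 \<or> F z = 1 \<or> z \<in> ?W" if "z \<in> K" for z
        using that KB F01 [of z] by auto
      ultimately have "K \<subseteq> {z \<in> topspace ?B. F z \<in> {0}} \<union> {z \<in> topspace ?B. F z \<in> {1}}"
        using KB unfolding disjnt_iff by blast
      moreover have "{z \<in> topspace ?B. F z \<in> {0}} \<inter> {z \<in> topspace ?B. F z \<in> {1}} \<inter> K = {}" by auto
      ultimately show False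
        using con closed [of 0] closed [of 1] hits [of 0] hits [of 1] two
        unfolding connectedin_closedin two_valued_modulo_def by blast
    qed
  qed
  then show ?thesis
    by (simp add: connected_modulo_pseudocompactness_def K_def
        hewitt_realcompactification_eq_extension_points [OF assms])
qed

end
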